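(* Let $q,a,b$ be complex numbers with $|q|<1$, $|a|<1$ and $a\neq 0$, and let $s\ge 0$ be an integer. For integers $n\ge 1$ set $$D(n)=\sum_{k=0}^{\infty}\frac{(bq^{2n-1}/a;q^2)_k\,(-bq/a;q^2)_k}{(q^2;q^2)_k\,(-q^{2n};q^2)_k}\,(a^2q)^k .$$ Then $$\frac{(a^2q^3;q^4)_\infty\,(b^2q^3;q^4)_\infty}{(a^2q;q^4)_\infty\,(b^2q;q^4)_\infty} =\frac{1}{1-ab}\;{\atop +}\;\frac{(a-bq)(b-aq)}{(1-ab)(1+q^2)}\;{\atop +}\;\frac{(a-bq^3)(b-aq^3)}{(1-ab)(1+q^4)}\;{\atop +\cdots +}\;\frac{(a-bq^{2s-1})(b-aq^{2s-1})}{(1-ab)(1+q^{2s})}\;{\atop +}\;\frac{(a-bq^{2s+1})(b-aq^{2s+1})}{(1+q^{2s+2})\,\dfrac{D(s+1)}{D(s+2)}} .$$ Explicitly: put $$W_s=\frac{(a-bq^{2s+1})(b-aq^{2s+1})}{(1+q^{2s+2})\,D(s+1)/D(s+2)},\qquad W_{j-1}=\frac{(a-bq^{2j-1})(b-aq^{2j-1})}{(1-ab)(1+q^{2j})+W_j}\quad (j=s,s-1,\dots,1).$$ Then the left-hand side above equals $\dfrac{1}{(1-ab)+W_0}$. (For $s=0$ the right-hand side is just $1/((1-ab)+W_0)$ with $W_0=\frac{(a-bq)(b-aq)}{(1+q^2)D(1)/D(2)}$.)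
   Context: For complex $x$ and $|p|<1$: $(x;p)_0=1$, $(x;p)_k=\prod_{j=0}^{k-1}(1-xp^j)$ for $k\ge1$, and $(x;p)_\infty=\prod_{j=0}^\infty(1-xp^j)$. The notation $\frac{a_1}{b_1}{\atop +}\frac{a_2}{b_2}{\atop +\cdots+}\frac{a_n}{b_n}$ denotes the nested fraction $\cfrac{a_1}{b_1+\cfrac{a_2}{b_2+\cdots+\cfrac{a_n}{b_n}}}$. By convention, the partial numerators $a_n$ of a continued fraction are nonzero (here: $(a-bq^{2j-1})(b-aq^{2j-1})\ne 0$ for all $j\ge 1$), and the maps $w\mapsto a_n/(b_n+w)$, as well as the values, are taken in the extended complex plane $\mathbb{C}\cup\{\infty\}$. *)

theory Defs
  imports "HOL-Analysis.Analysis"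
begin

section \<open>The extended complex plane\<close>

datatype ecomplex = Fin complex | CInf

text \<open>
  The indeterminate forms (\<open>CInf + CInf\<close>, \<open>Fin 0 * CInf\<close>, \<open>Fin 0 / Fin 0\<close>, \<open>CInf / CInf\<close>) are left
  \<^const>\<open>undefined\<close>, rather than being given a conventional value such as 0.
\<close>

instantiation ecomplex :: "{plus, times, inverse}"
begin

fun plus_ecomplex :: "ecomplex \<Rightarrow> ecomplex \<Rightarrow> ecomplex" where
  "Fin z + Fin w = Fin (z + w)"
| "Fin z + CInf = CInf"
| "CInf + Fin w = CInf"
| "CInf + CInf = undefined"

fun times_ecomplex :: "ecomplex \<Rightarrow> ecomplex \<Rightarrow> ecomplex" where
  "Fin z * Fin w = Fin (z * w)"
| "Fin z * CInf = (if z = 0 then undefined else CInf)"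
| "CInf * Fin w = (if w = 0 then undefined else CInf)"
| "CInf * CInf = CInf"

fun divide_ecomplex :: "ecomplex \<Rightarrow> ecomplex \<Rightarrow> ecomplex" where
  "divide (Fin z) (Fin w) = (if w \<noteq> 0 then Fin (z / w) else if z \<noteq> 0 then CInf else undefined)"
| "divide (Fin z) CInf = Fin 0"
| "divide CInf (Fin w) = CInf"
| "divide CInf CInf = undefined"

definition inverse_ecomplex :: "ecomplex \<Rightarrow> ecomplex" where
  "inverse z = divide (Fin 1) z"

instance ..

end

section \<open>Finite continued fractions\<close>

text \<open>
  \<open>cfrac [(a\<^sub>1, b\<^sub>1), \<dots>, (a\<^sub>n, b\<^sub>n)]\<close> is \<open>a\<^sub>1 / (b\<^sub>1 + a\<^sub>2 / (b\<^sub>2 + \<dots> + a\<^sub>n / b\<^sub>n))\<close>; the empty tail counts as 0,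
  so that the innermost fraction is \<open>a\<^sub>n / (b\<^sub>n + 0)\<close>.
\<close>

fun cfrac :: "(ecomplex \<times> ecomplex) list \<Rightarrow> ecomplex" where
  "cfrac [] = Fin 0"
| "cfrac ((a, b) # ps) = a / (b + cfrac ps)"

section \<open>Shifted factorials and the series\<close>

definition qpoch :: "complex \<Rightarrow> complex \<Rightarrow> nat \<Rightarrow> complex" where
  "qpoch x p k = (\<Prod>j<k. 1 - x * p ^ j)"

definition qpoch_inf :: "complex \<Rightarrow> complex \<Rightarrow> complex" where
  "qpoch_inf x p = (\<Prod>j. 1 - x * p ^ j)"

text \<open>Only used for \<open>n \<ge> 1\<close>, so that the natural-number exponent \<open>2 * n - 1\<close> is not truncated.\<close>

definition D :: "complex \<Rightarrow> complex \<Rightarrow> complex \<Rightarrow> nat \<Rightarrow> complex" where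
  "D q a b n =
     (\<Sum>k. qpoch (b * q ^ (2 * n - 1) / a) (q\<^sup>2) k * qpoch (- (b * q / a)) (q\<^sup>2) k
           / (qpoch (q\<^sup>2) (q\<^sup>2) k * qpoch (- (q ^ (2 * n))) (q\<^sup>2) k) * (a\<^sup>2 * q) ^ k)"

text \<open>The \<open>j\<close>-th partial numerator \<open>(a - b q\<^bsup>2j-1\<^esup>) (b - a q\<^bsup>2j-1\<^esup>)\<close>, for \<open>j \<ge> 1\<close>.\<close>

definition pnum :: "complex \<Rightarrow> complex \<Rightarrow> complex \<Rightarrow> nat \<Rightarrow> complex" where
  "pnum q a b j = (a - b * q ^ (2 * j - 1)) * (b - a * q ^ (2 * j - 1))"

end

theory Submission
  imports Defs
begin

text \<open>
  Up to the factor \<open>1 + q\<^bsup>2n\<^esup>\<close>, the tails of the continued fraction are ratios of consecutive values of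
  \<open>D\<close>. Indeed \<open>D n\<close> is a basic hypergeometric series \<open>\<Sum>\<^sub>k (A;p)\<^sub>k (B;p)\<^sub>k / ((p;p)\<^sub>k (C;p)\<^sub>k) z\<^sup>k\<close>
  with \<open>p = q\<^sup>2\<close>, and passing from \<open>n\<close> to \<open>n + 1\<close> multiplies \<open>A\<close> and \<open>C\<close> by \<open>p\<close>. The three series for
  \<open>n\<close>, \<open>n + 1\<close>, \<open>n + 2\<close> are linearly related (\<open>D_recurrence\<close>):

  \<open>(1 + q\<^bsup>2n\<^esup>) (1 + q\<^bsup>2n+2\<^esup>) D n = (1 - ab) (1 + q\<^bsup>2n\<^esup>) (1 + q\<^bsup>2n+2\<^esup>) D (n+1) + pnum (n+1) D (n+2)\<close>.

  Divided by \<open>(1 + q\<^bsup>2n+2\<^esup>) D (n+1)\<close>, this says that \<open>K\<^sub>n = (1 + q\<^bsup>2n\<^esup>) D n / D (n+1)\<close> satisfies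
  \<open>K\<^sub>n = (1 - ab) (1 + q\<^bsup>2n\<^esup>) + pnum (n+1) / K\<^sub>n\<^sub>+\<^sub>1\<close>, which is one step of the continued fraction.
  The innermost partial denominator is \<open>K\<^sub>s\<^sub>+\<^sub>1\<close>, so the fraction collapses from the inside outwards
  (\<open>cfrac_tail\<close>) to \<open>1 / ((1 - ab) + pnum 1 / K\<^sub>1)\<close>, which involves only \<open>D 1\<close> and \<open>D 2\<close>.

  This last quotient is a product because two of the series degenerate. At \<open>n = 1\<close> the numerator
  parameters are opposite, as are \<open>q\<^sup>2\<close> and the denominator parameter; pairing the factors leaves a
  series in base \<open>q\<^sup>4\<close> which the \<open>q\<close>-binomial theorem (\<open>q_binomial\<close>) sums (\<open>D_1_eq_product\<close>). The
  combination \<open>(1 - ab) (1 + q\<^sup>2) D 1 + pnum 1 D 2\<close> is \<open>1 + q\<^sup>2\<close> times another series of this kind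
  (\<open>D_first_step\<close>).

  In the extended plane one must also exclude indeterminate forms \<open>0 / 0\<close>. If \<open>D n\<close> and \<open>D (n+1)\<close>
  vanished together, the recurrence run downwards would give \<open>D 1 = D 2 = 0\<close>, and then
  \<open>(b\<^sup>2q;q\<^sup>4)\<^sub>\<infinity>\<close> and \<open>(b\<^sup>2q\<^sup>3;q\<^sup>4)\<^sub>\<infinity>\<close> would both vanish. A zero of the first means \<open>b\<^sup>2 q\<^sup>i = 1\<close> with
  \<open>i \<equiv> 1 (mod 4)\<close>, a zero of the second the same with \<open>i \<equiv> 3 (mod 4)\<close>, and \<open>|q| < 1\<close> allows at most
  one such \<open>i\<close> (\<open>consecutive_D_not_both_zero\<close>).
\<close>

section \<open>Shifted factorials\<close>

lemma summable_ratio_limit: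
  fixes f r :: "nat \<Rightarrow> complex"
  assumes f: "\<And>n. f (Suc n) = r n * f n" and r: "r \<longlonglongrightarrow> L" and L: "norm L < 1"
  shows "summable f"
proof -
  obtain c where c: "norm L < c" "c < 1" using L dense by blast
  have "(\<lambda>n. norm (r n)) \<longlonglongrightarrow> norm L" using r by (rule tendsto_norm)
  then have "\<forall>\<^sub>F n in sequentially. norm (r n) < c" using c(1) by (rule order_tendstoD)
  then obtain N where "\<And>n. n \<ge> N \<Longrightarrow> norm (r n) < c"
    by (auto simp: eventually_sequentially)
  then have "norm (f (Suc n)) \<le> c * norm (f n)" if "n \<ge> N" for n
    using that by (simp add: f norm_mult mult_right_mono less_imp_le)
  then show ?thesis by (rule summable_ratio_test[OF c(2)])
qed

lemma one_minus_mult_power_nonzero: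
  fixes x p :: complex
  assumes "norm x < 1" "norm p < 1"
  shows "1 - x * p ^ j \<noteq> 0"
proof
  assume "1 - x * p ^ j = 0"
  then have "norm (x * p ^ j) = 1" by (simp add: algebra_simps)
  moreover have "norm x * norm p ^ j \<le> norm x * 1"
    using assms by (intro mult_left_mono power_le_one) auto
  ultimately show False using assms by (simp add: norm_mult norm_power)
qed

lemma norm_power_less_one:
  fixes x :: complex
  assumes "norm x < 1" "n > 0"
  shows "norm (x ^ n) < 1"
  using assms by (simp add: norm_power power_less_one_iff)

lemma norm_square_mult_power_less_one:
  fixes a q :: complex
  assumes "norm q < 1" "norm a < 1" "k > 0"
  shows "norm (a\<^sup>2 * q ^ k) < 1"
proof -
  have "norm (a\<^sup>2) * norm (q ^ k) < 1 * 1"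
    using norm_power_less_one[OF assms(1,3)] norm_power_less_one[OF assms(2), of 2]
    by (intro mult_strict_mono) auto
  then show ?thesis by (simp add: norm_mult)
qed

lemma one_plus_power_nonzero:
  fixes q :: complex
  assumes "norm q < 1" "n > 0"
  shows "1 + q ^ n \<noteq> 0"
proof
  assume "1 + q ^ n = 0"
  then have "q ^ n = - 1" by (simp add: add_eq_0_iff)
  with norm_power_less_one[OF assms] show False by simp
qed

lemma qpoch_0 [simp]: "qpoch x p 0 = 1" by (simp add: qpoch_def)

lemma qpoch_Suc: "qpoch x p (Suc k) = qpoch x p k * (1 - x * p ^ k)"
  by (simp add: qpoch_def)

lemma qpoch_Suc_shift: "qpoch x p (Suc k) = (1 - x) * qpoch (x * p) p k"
  unfolding qpoch_def by (simp add: prod.lessThan_Suc_shift mult.assoc del: prod.lessThan_Suc)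

lemma qpoch_nonzero:
  assumes "norm x < 1" "norm p < 1"
  shows "qpoch x p k \<noteq> 0"
  unfolding qpoch_def using one_minus_mult_power_nonzero[OF assms] by simp

lemma convergent_prod_qpoch:
  fixes x p :: complex
  assumes "norm p < 1"
  shows "convergent_prod (\<lambda>j. 1 - x * p ^ j)"
proof -
  have "summable (\<lambda>j. norm (x * p ^ j))"
    using assms by (simp add: norm_mult norm_power summable_mult summable_geometric)
  then have "summable (\<lambda>j. norm ((1 - x * p ^ j) - 1))" by simp
  then show ?thesis
    by (intro abs_convergent_prod_imp_convergent_prod summable_imp_abs_convergent_prod)
qed

lemma qpoch_tendsto_qpoch_inf:
  assumes "norm p < 1"
  shows "qpoch x p \<longlonglongrightarrow> qpoch_inf x p"
proof -
  have "(\<lambda>n. \<Prod>j\<le>n. 1 - x * p ^ j) \<longlonglongrightarrow> qpoch_inf x p"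
    unfolding qpoch_inf_def by (rule convergent_prod_LIMSEQ[OF convergent_prod_qpoch[OF assms]])
  then have "(\<lambda>n. qpoch x p (Suc n)) \<longlonglongrightarrow> qpoch_inf x p"
    by (simp add: qpoch_def lessThan_Suc_atMost del: prod.lessThan_Suc)
  then show ?thesis by (simp only: filterlim_sequentially_Suc)
qed

lemma qpoch_inf_eq_0_iff:
  assumes "norm p < 1"
  shows "qpoch_inf x p = 0 \<longleftrightarrow> (\<exists>j. x * p ^ j = 1)"
proof -
  have "(\<lambda>j. 1 - x * p ^ j) has_prod qpoch_inf x p"
    unfolding qpoch_inf_def by (rule convergent_prod_has_prod[OF convergent_prod_qpoch[OF assms]])
  from has_prod_eq_0_iff[OF this] show ?thesis by auto
qed

lemma qpoch_inf_nonzero: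
  assumes "norm x < 1" "norm p < 1"
  shows "qpoch_inf x p \<noteq> 0"
  using one_minus_mult_power_nonzero[OF assms] qpoch_inf_eq_0_iff[OF assms(2)] by force

section \<open>The q-binomial theorem\<close>

text \<open>
  This is \<open>(c;Q)\<^sub>k / (Q;Q)\<^sub>k w\<^sup>k\<close> with \<open>v = c w\<close>. Writing the numerator homogeneously in \<open>w\<close> and \<open>v\<close> avoids
  the quotient \<open>c = v / w\<close>; below, \<open>w\<close> is a multiple of \<open>q\<close>, which may be 0.
\<close>

definition qbinom_term :: "complex \<Rightarrow> complex \<Rightarrow> complex \<Rightarrow> nat \<Rightarrow> complex" where
  "qbinom_term w v Q k = (\<Prod>i<k. w - v * Q ^ i) / qpoch Q Q k"

lemma qbinom_term_Suc:
  "qbinom_term w v Q (Suc k) = (w - v * Q ^ k) / (1 - Q * Q ^ k) * qbinom_term w v Q k"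
  by (simp add: qbinom_term_def qpoch_Suc mult_ac)

lemma summable_qbinom:
  assumes Q: "norm Q < 1" and wx: "norm (w * x) < 1"
  shows "summable (\<lambda>k. qbinom_term w v Q k * x ^ k)"
proof (rule summable_ratio_limit[OF _ _ wx])
  show "qbinom_term w v Q (Suc k) * x ^ Suc k
      = ((w - v * Q ^ k) / (1 - Q * Q ^ k) * x) * (qbinom_term w v Q k * x ^ k)" for k
    by (simp add: qbinom_term_Suc)
  have "(\<lambda>k. (w - v * Q ^ k) / (1 - Q * Q ^ k) * x) \<longlonglongrightarrow> (w - v * 0) / (1 - Q * 0) * x"
    using Q by (intro tendsto_intros LIMSEQ_power_zero) auto
  then show "(\<lambda>k. (w - v * Q ^ k) / (1 - Q * Q ^ k) * x) \<longlonglongrightarrow> w * x" by simp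
qed

text \<open>
  Put \<open>G x = \<Sum>\<^sub>k t\<^sub>k x\<^sup>k\<close>, where \<open>t\<^sub>k\<close> are the terms. The ratio of consecutive terms makes
  \<open>G x - G (Qx)\<close> equal to \<open>w x G x - v x G (Qx)\<close>, that is \<open>(1 - w x) G x = (1 - v x) G (Qx)\<close>.
  Iterating from \<open>x = 1\<close> produces the factors of both products one by one, and the remaining
  \<open>G (Q\<^sup>n)\<close> tends to \<open>G 0 = 1\<close>.
\<close>

theorem q_binomial:
  assumes Q: "norm Q < 1" and w: "norm w < 1"
  shows "(\<Sum>k. qbinom_term w v Q k) = qpoch_inf v Q / qpoch_inf w Q"
proof -
  define t where "t = qbinom_term w v Q"
  define G where "G x = (\<Sum>k. t k * x ^ k)" for x
  have sm: "summable (\<lambda>k. t k * x ^ k)" if "norm x \<le> 1" for x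
  proof -
    have "norm w * norm x \<le> norm w * 1" using that by (intro mult_left_mono) auto
    then show ?thesis unfolding t_def
      using w by (intro summable_qbinom[OF Q]) (simp add: norm_mult)
  qed
  have rec: "t (Suc k) * (1 - Q ^ Suc k) = t k * (w - v * Q ^ k)" for k
    using one_minus_mult_power_nonzero[OF Q Q, of k] by (simp add: t_def qbinom_term_Suc)
  have fe: "(1 - w * x) * G x = (1 - v * x) * G (x * Q)" if x: "norm x \<le> 1" for x
  proof -
    have "norm (x * Q) \<le> 1"
      using x Q mult_le_one[of "norm x" "norm Q"] by (simp add: norm_mult)
    note s = sm[OF x] sm[OF this]
    have "G x - G (x * Q) = (\<Sum>k. t k * x ^ k * (1 - Q ^ k))"
      unfolding G_def suminf_diff[OF s] by (simp add: algebra_simps power_mult_distrib)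
    also have "\<dots> = (\<Sum>k. t (Suc k) * x ^ Suc k * (1 - Q ^ Suc k))"
    proof -
      have "summable (\<lambda>k. t k * x ^ k * (1 - Q ^ k))"
        using summable_diff[OF s] by (simp add: algebra_simps power_mult_distrib)
      from suminf_split_head[OF this] show ?thesis by simp
    qed
    also have "\<dots> = (\<Sum>k. w * x * (t k * x ^ k) - v * x * (t k * (x * Q) ^ k))"
    proof (rule suminf_cong)
      fix k
      have "t (Suc k) * x ^ Suc k * (1 - Q ^ Suc k) = (t (Suc k) * (1 - Q ^ Suc k)) * x ^ Suc k"
        by (simp only: mult_ac)
      also have "\<dots> = w * x * (t k * x ^ k) - v * x * (t k * (x * Q) ^ k)"
        unfolding rec by (simp add: algebra_simps power_mult_distrib)
      finally show "t (Suc k) * x ^ Suc k * (1 - Q ^ Suc k)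
          = w * x * (t k * x ^ k) - v * x * (t k * (x * Q) ^ k)" .
    qed
    also have "\<dots> = w * x * G x - v * x * G (x * Q)"
      unfolding G_def using s by (simp add: suminf_diff[symmetric] suminf_mult summable_mult)
    finally show ?thesis by (simp add: algebra_simps)
  qed
  have it: "qpoch w Q n * G 1 = qpoch v Q n * G (Q ^ n)" for n
  proof (induction n)
    case (Suc n)
    have "norm (Q ^ n) \<le> 1" using Q by (simp add: norm_power power_le_one)
    from fe[OF this] have "(1 - w * Q ^ n) * G (Q ^ n) = (1 - v * Q ^ n) * G (Q ^ Suc n)"
      by (simp add: mult.commute)
    moreover have "qpoch w Q (Suc n) * G 1 = (1 - w * Q ^ n) * (qpoch w Q n * G 1)"
      by (simp add: qpoch_Suc mult_ac)
    ultimately show ?case unfolding Suc.IH by (simp add: qpoch_Suc mult_ac)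
  qed simp
  have "isCont G 0"
    unfolding G_def using sm[of 1] by (intro isCont_powser[where K = 1]) auto
  then have "(\<lambda>n. G (Q ^ n)) \<longlonglongrightarrow> G 0"
    using Q by (intro isCont_tendsto_compose[where g = G] LIMSEQ_power_zero) auto
  moreover have "G 0 = 1" unfolding G_def powser_zero by (simp add: t_def qbinom_term_def)
  ultimately have "(\<lambda>n. qpoch v Q n * G (Q ^ n)) \<longlonglongrightarrow> qpoch_inf v Q * 1"
    using qpoch_tendsto_qpoch_inf[OF Q] by (intro tendsto_mult) auto
  moreover have "(\<lambda>n. qpoch w Q n * G 1) \<longlonglongrightarrow> qpoch_inf w Q * G 1"
    by (intro tendsto_mult qpoch_tendsto_qpoch_inf[OF Q] tendsto_const)
  ultimately have "qpoch_inf w Q * G 1 = qpoch_inf v Q"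
    unfolding it using LIMSEQ_unique by fastforce
  moreover have "G 1 = (\<Sum>k. qbinom_term w v Q k)" by (simp add: G_def t_def)
  ultimately show ?thesis
    using qpoch_inf_nonzero[OF w Q] by (simp add: field_simps)
qed

section \<open>The three-term recurrence\<close>

text \<open>
  The summand of \<open>D\<close> with \<open>u = b / a\<close>, and with a free variable \<open>r\<close> in place of \<open>q\<^bsup>2n-1\<^esup>\<close>: raising \<open>n\<close> by one
  is multiplying \<open>r\<close> by \<open>q\<^sup>2\<close>, without truncated subtraction in exponents.
\<close>

definition D_term :: "complex \<Rightarrow> complex \<Rightarrow> complex \<Rightarrow> complex \<Rightarrow> nat \<Rightarrow> complex" where
  "D_term q a u r k =
     qpoch (u * r) (q\<^sup>2) k * qpoch (- (u * q)) (q\<^sup>2) k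
     / (qpoch (q\<^sup>2) (q\<^sup>2) k * qpoch (- (r * q)) (q\<^sup>2) k) * (a\<^sup>2 * q) ^ k"

lemma D_eq_suminf:
  assumes "n \<ge> 1"
  shows "D q a b n = (\<Sum>k. D_term q a (b / a) (q ^ (2 * n - 1)) k)"
proof -
  have "q ^ (2 * n - 1) * q = q ^ (2 * n)"
    using assms by (cases n) auto
  then show ?thesis by (simp add: D_def D_term_def)
qed

lemma D_term_0 [simp]: "D_term q a u r 0 = 1"
  by (simp add: D_term_def)

lemma D_term_Suc:
  "D_term q a u r (Suc k) =
     (1 - u * r * (q\<^sup>2) ^ k) * (1 + u * q * (q\<^sup>2) ^ k) * (a\<^sup>2 * q)
     / ((1 - q\<^sup>2 * (q\<^sup>2) ^ k) * (1 + r * q * (q\<^sup>2) ^ k)) * D_term q a u r k"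
  by (simp add: D_term_def qpoch_Suc mult_ac)

lemma summable_D_term:
  assumes q: "norm q < 1" and a: "norm a < 1"
  shows "summable (D_term q a u r)"
proof (rule summable_ratio_limit)
  show "D_term q a u r (Suc k) =
      ((1 - u * r * (q\<^sup>2) ^ k) * (1 + u * q * (q\<^sup>2) ^ k) * (a\<^sup>2 * q)
        / ((1 - q\<^sup>2 * (q\<^sup>2) ^ k) * (1 + r * q * (q\<^sup>2) ^ k))) * D_term q a u r k" for k
    by (rule D_term_Suc)
  show "(\<lambda>k. (1 - u * r * (q\<^sup>2) ^ k) * (1 + u * q * (q\<^sup>2) ^ k) * (a\<^sup>2 * q)
        / ((1 - q\<^sup>2 * (q\<^sup>2) ^ k) * (1 + r * q * (q\<^sup>2) ^ k))) \<longlonglongrightarrow>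
      (1 - u * r * 0) * (1 + u * q * 0) * (a\<^sup>2 * q) / ((1 - q\<^sup>2 * 0) * (1 + r * q * 0))"
    using norm_power_less_one[OF q, of 2]
    by (intro tendsto_intros LIMSEQ_power_zero) auto
  show "norm ((1 - u * r * 0) * (1 + u * q * 0) * (a\<^sup>2 * q)
      / ((1 - q\<^sup>2 * 0) * (1 + r * q * 0))) < 1"
    using norm_square_mult_power_less_one[OF q a, of 1] by simp
qed

text \<open>
  This is the coefficientwise form of the recurrence. The series for \<open>r\<close> has parameters \<open>A = u r\<close>,
  \<open>B = - u q\<close>, \<open>C = - r q\<close> in base \<open>p = q\<^sup>2\<close>. All four terms share the factor \<open>G\<close> below; what remains is
  a polynomial identity in \<open>u, r, q, a\<close> and \<open>y = p\<^sup>m\<close>. For arbitrary \<open>A, B, C\<close>, with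
  \<open>a b\<close> read as \<open>- B z / p\<close> and the partial numerator as \<open>- (1 - A p) (B - C p) z / p\<close>, where \<open>z = a\<^sup>2 q\<close>,
  the two sides of that identity would differ by a multiple of \<open>B C - A p\<close>, which is zero for these
  parameters. This reading also shows why the index of the last two terms lags by one: their
  coefficients carry the missing power of \<open>z\<close>. At index 0 the first two terms cancel.
\<close>

lemma D_term_recurrence:
  assumes q: "norm q < 1" and r: "norm r \<le> 1"
  shows "(1 + r * q) * (1 + r * q ^ 3) *
           (D_term q a u r (Suc m) - D_term q a u (r * q\<^sup>2) (Suc m)
            + a * (u * a) * D_term q a u (r * q\<^sup>2) m)
       = (a - u * a * r * q\<^sup>2) * (u * a - a * r * q\<^sup>2) * D_term q a u (r * q ^ 4) m"
proof -
  define y where "y = (q\<^sup>2) ^ m"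
  define \<alpha> where "\<alpha> = qpoch (u * r * q\<^sup>2) (q\<^sup>2) m"
  define \<alpha>' where "\<alpha>' = qpoch (u * r * q ^ 4) (q\<^sup>2) m"
  define \<beta> where "\<beta> = qpoch (- (u * q)) (q\<^sup>2) m"
  define \<gamma> where "\<gamma> = qpoch (q\<^sup>2) (q\<^sup>2) m"
  define \<delta> where "\<delta> = qpoch (- (r * q ^ 5)) (q\<^sup>2) m"
  define \<epsilon> where "\<epsilon> = qpoch (- (r * q ^ 3)) (q\<^sup>2) m"
  define Z where "Z = (a\<^sup>2 * q) ^ m"
  have q2: "norm (q\<^sup>2) < 1" using norm_power_less_one[OF q] by simp
  have rq: "norm (- (r * q ^ i)) < 1" if "i > 0" for i
  proof -
    have "norm r * norm (q ^ i) \<le> 1 * norm (q ^ i)" using r by (intro mult_right_mono) auto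
    then show ?thesis using norm_power_less_one[OF q that] by (simp add: norm_mult)
  qed
  have nz: "\<gamma> \<noteq> 0" "\<delta> \<noteq> 0" "\<epsilon> \<noteq> 0" "1 - q\<^sup>2 * y \<noteq> 0" "1 + r * q ^ 3 * y \<noteq> 0"
      "1 + r * q \<noteq> 0" "1 + r * q ^ 3 \<noteq> 0"
    using qpoch_nonzero[OF q2 q2] qpoch_nonzero[OF rq[of 5] q2] qpoch_nonzero[OF rq[of 3] q2]
      one_minus_mult_power_nonzero[OF q2 q2, of m] one_minus_mult_power_nonzero[OF rq[of 3] q2, of m]
      one_minus_mult_power_nonzero[OF rq[of 3] q2, of 0] one_minus_mult_power_nonzero[OF rq[of 1] q2, of 0]
    by (auto simp: \<gamma>_def \<delta>_def \<epsilon>_def y_def)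
  \<comment> \<open>Both sides are \<open>(u r q\<^sup>2;q\<^sup>2)\<^sub>m\<^sub>+\<^sub>1\<close>, split at either end. A quotient would be unsafe here, since
      \<open>1 - u r q\<^sup>2\<close> may vanish; this factor is supplied by \<open>a - b r q\<^sup>2\<close> in the partial numerator.\<close>
  have A: "(1 - u * r * q\<^sup>2) * \<alpha>' = \<alpha> * (1 - u * r * q\<^sup>2 * y)"
    unfolding \<alpha>_def \<alpha>'_def y_def using qpoch_Suc[of "u * r * q\<^sup>2" "q\<^sup>2" m] qpoch_Suc_shift[of "u * r * q\<^sup>2" "q\<^sup>2" m]
    by (simp add: mult.assoc flip: power_add)
  have E: "\<epsilon> * (1 + r * q ^ 3 * y) = (1 + r * q ^ 3) * \<delta>"
    unfolding \<epsilon>_def \<delta>_def y_def using qpoch_Suc[of "-(r * q ^ 3)" "q\<^sup>2" m] qpoch_Suc_shift[of "-(r * q ^ 3)" "q\<^sup>2" m]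
    by (simp add: mult.assoc flip: power_add)
  have e: "\<epsilon> = (1 + r * q ^ 3) * \<delta> / (1 + r * q ^ 3 * y)"
    using E nz by (simp add: field_simps)
  define G where "G = \<alpha> * \<beta> * Z / (\<gamma> * (1 - q\<^sup>2 * y) * \<delta>)"
  have 1: "(1 + r * q) * (1 + r * q ^ 3) * D_term q a u r (Suc m)
      = G * ((1 - u * r) * (1 + u * q * y) * (a\<^sup>2 * q) * (1 + r * q ^ 3 * y))"
  proof -
    have eq: "D_term q a u r (Suc m) = ((1 - u * r) * \<alpha>) * (\<beta> * (1 + u * q * y))
        / (\<gamma> * (1 - q\<^sup>2 * y) * ((1 + r * q) * \<epsilon>)) * (a\<^sup>2 * q * Z)"
      unfolding D_term_def qpoch_Suc_shift[of "u * r"] qpoch_Suc_shift[of "- (r * q)"]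
        qpoch_Suc[of "- (u * q)"] qpoch_Suc[of "q\<^sup>2"]
      by (simp add: \<alpha>_def \<beta>_def \<gamma>_def \<epsilon>_def Z_def y_def power2_eq_square power3_eq_cube mult.assoc)
    show ?thesis unfolding G_def eq e using nz by (simp add: divide_simps)
  qed
  have 2: "(1 + r * q) * (1 + r * q ^ 3) * D_term q a u (r * q\<^sup>2) (Suc m)
      = G * ((1 - u * r * q\<^sup>2 * y) * (1 + u * q * y) * (a\<^sup>2 * q) * (1 + r * q))"
  proof -
    have rq: "r * q\<^sup>2 * q = r * q ^ 3" by algebra
    have eq: "D_term q a u (r * q\<^sup>2) (Suc m) = (\<alpha> * (1 - u * r * q\<^sup>2 * y)) * (\<beta> * (1 + u * q * y))
        / (\<gamma> * (1 - q\<^sup>2 * y) * (\<epsilon> * (1 + r * q ^ 3 * y))) * (a\<^sup>2 * q * Z)"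
      unfolding D_term_def qpoch_Suc rq
      by (simp add: \<alpha>_def \<beta>_def \<gamma>_def \<epsilon>_def Z_def y_def mult.assoc)
    show ?thesis unfolding G_def eq E using nz by (simp add: divide_simps)
  qed
  have 3: "(1 + r * q) * (1 + r * q ^ 3) * D_term q a u (r * q\<^sup>2) m
      = G * ((1 - q\<^sup>2 * y) * (1 + r * q) * (1 + r * q ^ 3 * y))"
  proof -
    have rq: "r * q\<^sup>2 * q = r * q ^ 3" by algebra
    have eq: "D_term q a u (r * q\<^sup>2) m = \<alpha> * \<beta> / (\<gamma> * \<epsilon>) * Z"
      unfolding D_term_def rq
      by (simp add: \<alpha>_def \<beta>_def \<gamma>_def \<epsilon>_def Z_def mult.assoc)
    show ?thesis unfolding G_def eq e using nz by (simp add: divide_simps)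
  qed
  have 4: "(a - u * a * r * q\<^sup>2) * D_term q a u (r * q ^ 4) m
      = G * (a * (1 - u * r * q\<^sup>2 * y) * (1 - q\<^sup>2 * y))"
  proof -
    have rq: "r * q ^ 4 * q = r * q ^ 5" by algebra
    have eq': "D_term q a u (r * q ^ 4) m = \<alpha>' * \<beta> / (\<gamma> * \<delta>) * Z"
      unfolding D_term_def rq
      by (simp add: \<alpha>'_def \<beta>_def \<gamma>_def \<delta>_def Z_def mult.assoc)
    have eq: "(a - u * a * r * q\<^sup>2) * D_term q a u (r * q ^ 4) m
        = a * ((1 - u * r * q\<^sup>2) * \<alpha>') * \<beta> / (\<gamma> * \<delta>) * Z"
    proof -
      have "a - u * a * r * q\<^sup>2 = a * (1 - u * r * q\<^sup>2)" by (simp add: algebra_simps)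
      then show ?thesis unfolding eq' by simp
    qed
    show ?thesis unfolding G_def eq A using nz by (simp add: divide_simps)
  qed
  have P: "(1 - u * r) * (1 + u * q * y) * (a\<^sup>2 * q) * (1 + r * q ^ 3 * y)
      - (1 - u * r * q\<^sup>2 * y) * (1 + u * q * y) * (a\<^sup>2 * q) * (1 + r * q)
      + a * (u * a) * ((1 - q\<^sup>2 * y) * (1 + r * q) * (1 + r * q ^ 3 * y))
      = (u * a - a * r * q\<^sup>2) * (a * (1 - u * r * q\<^sup>2 * y) * (1 - q\<^sup>2 * y))"
    by algebra
  show ?thesis using 1 2 3 4 P by algebra
qed


lemma D_term_sum_recurrence:
  assumes q: "norm q < 1" and a: "norm a < 1" and r: "norm r \<le> 1"
  shows "(1 + r * q) * (1 + r * q ^ 3) *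
           ((\<Sum>k. D_term q a u r k) - (1 - a * (u * a)) * (\<Sum>k. D_term q a u (r * q\<^sup>2) k))
       = (a - u * a * r * q\<^sup>2) * (u * a - a * r * q\<^sup>2) * (\<Sum>k. D_term q a u (r * q ^ 4) k)"
proof -
  note sm = summable_D_term[OF q a]
  note sm' = sm[THEN summable_ignore_initial_segment, of _ _ 1, simplified]
  have split: "(\<Sum>k. D_term q a u r k) = 1 + (\<Sum>m. D_term q a u r (Suc m))" for r
    using suminf_split_head[OF sm, of u r] by simp
  have "(a - u * a * r * q\<^sup>2) * (u * a - a * r * q\<^sup>2) * (\<Sum>m. D_term q a u (r * q ^ 4) m)
      = (\<Sum>m. (1 + r * q) * (1 + r * q ^ 3) *
           (D_term q a u r (Suc m) - D_term q a u (r * q\<^sup>2) (Suc m)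
            + a * (u * a) * D_term q a u (r * q\<^sup>2) m))"
    unfolding D_term_recurrence[OF q r] using suminf_mult[OF sm] by simp
  also have "\<dots> = (1 + r * q) * (1 + r * q ^ 3) *
       ((\<Sum>m. D_term q a u r (Suc m)) - (\<Sum>m. D_term q a u (r * q\<^sup>2) (Suc m))
        + a * (u * a) * (\<Sum>m. D_term q a u (r * q\<^sup>2) m))"
    by (intro sums_unique[symmetric] sums_mult sums_add sums_diff summable_sums sm sm')
  finally show ?thesis unfolding split[of r] using split[of "r * q\<^sup>2"] by (simp add: algebra_simps)
qed

lemma D_recurrence:
  assumes q: "norm q < 1" and a: "norm a < 1" "a \<noteq> 0" and n: "n \<ge> 1"
  shows "(1 + q ^ (2 * n)) * (1 + q ^ (2 * n + 2)) * D q a b n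
       = (1 - a * b) * (1 + q ^ (2 * n)) * (1 + q ^ (2 * n + 2)) * D q a b (n + 1)
         + pnum q a b (n + 1) * D q a b (n + 2)"
proof -
  define r where "r = q ^ (2 * n - 1)"
  obtain k where k: "n = Suc k" using n by (cases n) auto
  have "norm r \<le> 1" unfolding r_def using q by (simp add: norm_power power_le_one)
  from D_term_sum_recurrence[OF q a(1) this, of "b / a"]
  have *: "(1 + r * q) * (1 + r * q ^ 3) *
      ((\<Sum>k. D_term q a (b / a) r k) - (1 - a * b) * (\<Sum>k. D_term q a (b / a) (r * q\<^sup>2) k))
    = (a - b * (r * q\<^sup>2)) * (b - a * (r * q\<^sup>2)) * (\<Sum>k. D_term q a (b / a) (r * q ^ 4) k)"
    using a(2) by (simp add: mult.assoc)
  have p: "r * q = q ^ (2 * n)" "r * q ^ 3 = q ^ (2 * n + 2)"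
      "r * q\<^sup>2 = q ^ (2 * (n + 1) - 1)" "r * q ^ 4 = q ^ (2 * (n + 2) - 1)"
    unfolding r_def k by (simp_all add: power2_eq_square eval_nat_numeral)
  have D: "(\<Sum>k. D_term q a (b / a) r k) = D q a b n"
      "(\<Sum>k. D_term q a (b / a) (r * q\<^sup>2) k) = D q a b (n + 1)"
      "(\<Sum>k. D_term q a (b / a) (r * q ^ 4) k) = D q a b (n + 2)"
    unfolding p using n by (simp_all only: r_def D_eq_suminf le_add2 trans_le_add1)
  have "pnum q a b (n + 1) = (a - b * (r * q\<^sup>2)) * (b - a * (r * q\<^sup>2))"
    unfolding p(3) by (simp add: pnum_def)
  with * show ?thesis
    unfolding D p(1,2) by (simp only: right_diff_distrib diff_eq_eq mult_ac add_ac)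
qed

section \<open>The outermost step\<close>

text \<open>
  At \<open>n = 1\<close> the symbols pair up as \<open>(x;q\<^sup>2)\<^sub>k (-x;q\<^sup>2)\<^sub>k = (x\<^sup>2;q\<^sup>4)\<^sub>k\<close>, with \<open>x = b q / a\<close> in the numerator
  and \<open>x = q\<^sup>2\<close> in the denominator.
\<close>

lemma D_term_eq_qbinom_term:
  assumes q: "norm q < 1" and a: "a \<noteq> 0"
  shows "D_term q a (b / a) q k = qbinom_term (a\<^sup>2 * q) (b\<^sup>2 * q ^ 3) (q ^ 4) k"
proof (induction k)
  case (Suc k)
  define y where "y = (q\<^sup>2) ^ k"
  have y: "(q ^ 4) ^ k = y\<^sup>2" unfolding y_def by (simp flip: power_mult add: mult.commute)
  have "(1 - b / a * q * y) * (1 + b / a * q * y) * (a\<^sup>2 * q) = a\<^sup>2 * q - b\<^sup>2 * q ^ 3 * y\<^sup>2"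
    using a by (simp add: field_simps) algebra
  moreover have "(1 - q\<^sup>2 * y) * (1 + q * q * y) = 1 - q ^ 4 * y\<^sup>2" by algebra
  ultimately show ?case
    unfolding D_term_Suc qbinom_term_Suc Suc.IH y y_def[symmetric] by simp
qed (simp add: qbinom_term_def)

lemma D_1_eq_product:
  assumes q: "norm q < 1" and a: "norm a < 1" "a \<noteq> 0"
  shows "D q a b 1 = qpoch_inf (b\<^sup>2 * q ^ 3) (q ^ 4) / qpoch_inf (a\<^sup>2 * q) (q ^ 4)"
proof -
  have w: "norm (a\<^sup>2 * q) < 1" using norm_square_mult_power_less_one[OF q a(1), of 1] by simp
  have "norm (q ^ 4) < 1" using norm_power_less_one[OF q] by simp
  from q_binomial[OF this w] show ?thesis
    by (simp add: D_eq_suminf D_term_eq_qbinom_term[OF q a(2)])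
qed

text \<open>
  The recurrence at \<open>n = 0\<close> would involve \<open>q\<^bsup>-1\<^esup>\<close>, and \<open>1 + q\<^bsup>2n\<^esup> = 2\<close> does not match the outermost partial
  denominator \<open>1 - a b\<close>. But the combination of \<open>D 1\<close> and \<open>D 2\<close> that occurs there is again a
  \<open>q\<close>-binomial series: by \<open>b1\<close>, \<open>b2\<close> and \<open>b3\<close> below, each term is a rational multiple of the \<open>m\<close>-th
  summand \<open>w\<close> of \<open>D 1\<close>, and the multipliers agree.
\<close>

lemma first_step_term:
  assumes q: "norm q < 1" and a: "a \<noteq> 0"
  shows "D_term q a (b / a) q (Suc m) - a * b * D_term q a (b / a) q m
         + (a - b * q) * (b - a * q) / (1 + q\<^sup>2) * D_term q a (b / a) (q ^ 3) m
       = qbinom_term (a\<^sup>2 * q ^ 3) (b\<^sup>2 * q) (q ^ 4) (Suc m)"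
proof -
  define y where "y = (q\<^sup>2) ^ m"
  define w where "w = D_term q a (b / a) q m"
  have y: "(q ^ 4) ^ m = y\<^sup>2" unfolding y_def by (simp flip: power_mult add: mult.commute)
  have q2: "norm (q\<^sup>2) < 1" and q2': "norm (- q\<^sup>2) < 1" and q4: "norm (- (q ^ 4)) < 1"
    using norm_power_less_one[OF q] by simp_all
  have nz: "1 - q\<^sup>2 * y \<noteq> 0" "1 + q\<^sup>2 * y \<noteq> 0" "1 + q\<^sup>2 \<noteq> 0"
      "qpoch (q\<^sup>2) (q\<^sup>2) m \<noteq> 0" "qpoch (- (q\<^sup>2)) (q\<^sup>2) m \<noteq> 0" "qpoch (- (q ^ 4)) (q\<^sup>2) m \<noteq> 0"
    using one_minus_mult_power_nonzero[OF q2 q2, of m] one_minus_mult_power_nonzero[OF q2' q2, of m]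
      one_minus_mult_power_nonzero[OF q2' q2, of 0] qpoch_nonzero[OF q2 q2]
      qpoch_nonzero[OF q2' q2] qpoch_nonzero[OF q4 q2]
    by (auto simp: y_def)
  have y4: "1 - q ^ 4 * y\<^sup>2 = (1 - q\<^sup>2 * y) * (1 + q\<^sup>2 * y)" by algebra
  have b1: "D_term q a (b / a) q (Suc m) = (a\<^sup>2 * q - b\<^sup>2 * q ^ 3 * y\<^sup>2) / (1 - q ^ 4 * y\<^sup>2) * w"
    unfolding w_def D_term_eq_qbinom_term[OF q a] qbinom_term_Suc y ..
  have b2_cleared: "(a - b * q) * D_term q a (b / a) (q ^ 3) m * (1 + q\<^sup>2 * y) = (a - b * q * y) * (1 + q\<^sup>2) * w"
  proof -
    define A where "A = qpoch (b / a * q ^ 3) (q\<^sup>2) m"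
    define A' where "A' = qpoch (b / a * q) (q\<^sup>2) m"
    define C where "C = qpoch (- (q ^ 4)) (q\<^sup>2) m"
    define C' where "C' = qpoch (- (q\<^sup>2)) (q\<^sup>2) m"
    define R where "R = qpoch (- (b / a * q)) (q\<^sup>2) m / qpoch (q\<^sup>2) (q\<^sup>2) m * (a\<^sup>2 * q) ^ m"
    have e: "q * q\<^sup>2 = q ^ 3" "q\<^sup>2 * q\<^sup>2 = q ^ 4" "q ^ 3 * q = q ^ 4" by algebra+
    have "(1 - b / a * q) * A = A' * (1 - b / a * q * y)"
      using qpoch_Suc[of "b / a * q" "q\<^sup>2" m] qpoch_Suc_shift[of "b / a * q" "q\<^sup>2" m]
      by (simp add: A_def A'_def y_def mult.assoc e)
    then have A: "(a - b * q) * A = A' * (a - b * q * y)" using a by (simp add: field_simps)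
    have C: "(1 + q\<^sup>2) * C = C' * (1 + q\<^sup>2 * y)"
      using qpoch_Suc[of "- (q\<^sup>2)" "q\<^sup>2" m] qpoch_Suc_shift[of "- (q\<^sup>2)" "q\<^sup>2" m]
      by (simp add: C_def C'_def y_def e)
    have nC: "C \<noteq> 0" "C' \<noteq> 0" using nz by (auto simp: C_def C'_def)
    have "D_term q a (b / a) (q ^ 3) m = A / C * R"
      unfolding D_term_def e by (simp add: A_def C_def R_def mult_ac)
    then have "(a - b * q) * D_term q a (b / a) (q ^ 3) m * (1 + q\<^sup>2 * y)
        = ((a - b * q) * A) * (1 + q\<^sup>2 * y) / C * R" by simp
    also have "\<dots> = (a - b * q * y) * A' * R * ((1 + q\<^sup>2 * y) / C)" unfolding A by simp
    also have "(1 + q\<^sup>2 * y) / C = (1 + q\<^sup>2) / C'" using C nC by (simp add: field_simps)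
    finally show ?thesis
      by (simp add: w_def D_term_def A'_def C'_def R_def flip: power2_eq_square)
  qed
  \<comment> \<open>All factors but the first are \<open>q\<^sup>2\<close> times the factors for \<open>D 1\<close>, since \<open>q\<^sup>4 q = q\<^sup>2 q\<^sup>3\<close>.\<close>
  have "(\<Prod>i<Suc m. a\<^sup>2 * q ^ 3 - b\<^sup>2 * q * (q ^ 4) ^ i)
      = (a\<^sup>2 * q ^ 3 - b\<^sup>2 * q) * (\<Prod>i<m. q\<^sup>2 * (a\<^sup>2 * q - b\<^sup>2 * q ^ 3 * (q ^ 4) ^ i))"
    unfolding prod.lessThan_Suc_shift
    by (intro arg_cong2[where f = "(*)"] prod.cong) (auto simp: algebra_simps eval_nat_numeral)
  also have "\<dots> = (a\<^sup>2 * q ^ 3 - b\<^sup>2 * q) * y * (\<Prod>i<m. a\<^sup>2 * q - b\<^sup>2 * q ^ 3 * (q ^ 4) ^ i)"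
    by (simp add: prod.distrib y_def)
  finally have b3: "qbinom_term (a\<^sup>2 * q ^ 3) (b\<^sup>2 * q) (q ^ 4) (Suc m)
      = (a\<^sup>2 * q ^ 3 - b\<^sup>2 * q) * y / (1 - q ^ 4 * y\<^sup>2) * w"
    unfolding w_def D_term_eq_qbinom_term[OF q a] by (simp add: qbinom_term_def qpoch_Suc y mult_ac)
  have b2: "(a - b * q) * (b - a * q) / (1 + q\<^sup>2) * D_term q a (b / a) (q ^ 3) m
      = (a - b * q * y) * (b - a * q) / (1 + q\<^sup>2 * y) * w"
    using b2_cleared nz by (simp add: divide_simps) (simp add: mult_ac)
  have "(a\<^sup>2 * q - b\<^sup>2 * q ^ 3 * y\<^sup>2) / (1 - q ^ 4 * y\<^sup>2) - a * b
        + (a - b * q * y) * (b - a * q) / (1 + q\<^sup>2 * y)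
      = (a\<^sup>2 * q ^ 3 - b\<^sup>2 * q) * y / (1 - q ^ 4 * y\<^sup>2)"
    unfolding y4 using nz by (simp add: divide_simps) algebra
  then show ?thesis unfolding b1 b2 b3 w_def[symmetric] by (metis distrib_right left_diff_distrib)
qed

lemma D_first_step:
  assumes q: "norm q < 1" and a: "norm a < 1" "a \<noteq> 0"
  shows "(1 - a * b) * (1 + q\<^sup>2) * D q a b 1 + pnum q a b 1 * D q a b 2
       = (1 + q\<^sup>2) * (qpoch_inf (b\<^sup>2 * q) (q ^ 4) / qpoch_inf (a\<^sup>2 * q ^ 3) (q ^ 4))"
proof -
  note sm = summable_D_term[OF q a(1), of "b / a"]
  note sm' = sm[THEN summable_ignore_initial_segment, of _ 1, simplified]
  define c where "c = (a - b * q) * (b - a * q) / (1 + q\<^sup>2)"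
  let ?t = "qbinom_term (a\<^sup>2 * q ^ 3) (b\<^sup>2 * q) (q ^ 4)"
  have q4: "norm (q ^ 4) < 1" using norm_power_less_one[OF q] by simp
  have w: "norm (a\<^sup>2 * q ^ 3) < 1" by (rule norm_square_mult_power_less_one[OF q a(1)]) simp
  have nz: "1 + q\<^sup>2 \<noteq> 0" by (rule one_plus_power_nonzero[OF q]) simp
  have "summable ?t" using summable_qbinom[OF q4, of _ 1] w by simp
  from suminf_split_head[OF this]
  have "qpoch_inf (b\<^sup>2 * q) (q ^ 4) / qpoch_inf (a\<^sup>2 * q ^ 3) (q ^ 4) = 1 + (\<Sum>m. ?t (Suc m))"
    by (simp add: q_binomial[OF q4 w]) (simp add: qbinom_term_def)
  also have "(\<Sum>m. ?t (Suc m)) = (\<Sum>m. D_term q a (b / a) q (Suc m))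
      - a * b * (\<Sum>m. D_term q a (b / a) q m) + c * (\<Sum>m. D_term q a (b / a) (q ^ 3) m)"
    unfolding first_step_term[OF q a(2), symmetric] c_def
    by (intro sums_unique[symmetric] sums_mult sums_add sums_diff summable_sums sm sm')
  also have "(\<Sum>m. D_term q a (b / a) q (Suc m)) = D q a b 1 - 1"
    using suminf_split_head[OF sm, of q] by (simp add: D_eq_suminf)
  finally have "qpoch_inf (b\<^sup>2 * q) (q ^ 4) / qpoch_inf (a\<^sup>2 * q ^ 3) (q ^ 4)
      = (1 - a * b) * D q a b 1 + c * D q a b 2"
    by (simp add: D_eq_suminf algebra_simps)
  moreover have "pnum q a b 1 = (1 + q\<^sup>2) * c"
    using nz by (simp add: pnum_def c_def)
  ultimately show ?thesis by (simp only: distrib_left mult_ac)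
qed

section \<open>No indeterminate forms\<close>

text \<open>
  A common zero would give \<open>x q\<^sup>k = 1 = x q\<^sup>l\<close> with \<open>k \<equiv> 1\<close> and \<open>l \<equiv> 3\<close> modulo 4, although the
  absolute values of the powers of \<open>q \<noteq> 0\<close> are strictly decreasing.
\<close>

lemma qpoch_inf_odd_classes_not_both_zero:
  assumes q: "norm q < 1"
  shows "qpoch_inf (x * q) (q ^ 4) \<noteq> 0 \<or> qpoch_inf (x * q ^ 3) (q ^ 4) \<noteq> 0"
proof (rule ccontr)
  assume "\<not> ?thesis"
  moreover have "norm (q ^ 4) < 1" using norm_power_less_one[OF q] by simp
  ultimately obtain i j where "x * q * (q ^ 4) ^ i = 1" "x * q ^ 3 * (q ^ 4) ^ j = 1"
    by (auto simp: qpoch_inf_eq_0_iff)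
  then have ij: "x * q ^ (4 * i + 1) = 1" "x * q ^ (4 * j + 3) = 1"
    by (simp_all add: power_add mult_ac flip: power_mult)
  have "norm q ^ (4 * i + 1) = norm q ^ (4 * j + 3)"
    using ij by (metis mult_cancel_left norm_power mult_zero_left zero_neq_one)
  moreover have "norm q \<noteq> 0" using ij(1) by auto
  ultimately have "4 * i + 1 = 4 * j + 3"
    using q power_strict_decreasing[of "4 * i + 1" "4 * j + 3" "norm q"]
      power_strict_decreasing[of "4 * j + 3" "4 * i + 1" "norm q"]
    by (metis linorder_neqE_nat less_irrefl zero_less_norm_iff norm_eq_zero)
  then show False by presburger
qed

text \<open>
  Since \<open>1 + q\<^bsup>2n\<^esup>\<close> and \<open>1 + q\<^bsup>2n+2\<^esup>\<close> are nonzero, the recurrence carries a common zero of \<open>D (n+1)\<close> and \<open>D (n+2)\<close> down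
  to \<open>D n\<close>, so only \<open>n = 1\<close> has to be excluded; there the two product formulas reduce the
  claim to \<open>qpoch_inf_odd_classes_not_both_zero\<close>.
\<close>

lemma consecutive_D_not_both_zero:
  assumes q: "norm q < 1" and a: "norm a < 1" "a \<noteq> 0" and n: "n \<ge> 1"
  shows "D q a b n \<noteq> 0 \<or> D q a b (n + 1) \<noteq> 0"
  using n
proof (induction n rule: dec_induct)
  case base
  have q4: "norm (q ^ 4) < 1" using norm_power_less_one[OF q] by simp
  have w: "norm (a\<^sup>2 * q) < 1" "norm (a\<^sup>2 * q ^ 3) < 1"
    using norm_square_mult_power_less_one[OF q a(1), of 1]
      norm_square_mult_power_less_one[OF q a(1), of 3] by simp_all
  have "qpoch_inf (a\<^sup>2 * q) (q ^ 4) \<noteq> 0" "qpoch_inf (a\<^sup>2 * q ^ 3) (q ^ 4) \<noteq> 0"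
    using qpoch_inf_nonzero[OF _ q4] w by blast+
  then show ?case
    using D_1_eq_product[OF q a, of b] D_first_step[OF q a, of b] one_plus_power_nonzero[OF q, of 2]
      qpoch_inf_odd_classes_not_both_zero[OF q, of "b\<^sup>2"]
    by (auto simp: numeral_2_eq_2)
next
  case (step n)
  show ?case
  proof (rule ccontr)
    assume "\<not> ?thesis"
    then have "(1 + q ^ (2 * n)) * (1 + q ^ (2 * n + 2)) * D q a b n = 0"
      unfolding D_recurrence[OF q a step(1)] by simp
    then have "D q a b n = 0"
      using one_plus_power_nonzero[OF q, of "2 * n"] one_plus_power_nonzero[OF q, of "2 * n + 2"] step(1)
      by simp
    with step \<open>\<not> ?thesis\<close> show False by simp
  qed
qed

section \<open>Collapsing the continued fraction\<close>

text \<open>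
  A quotient \<open>Fin x / Fin y\<close> with \<open>x\<close> and \<open>y\<close> not both zero is a point of the projective line with
  homogeneous coordinates \<open>x\<close>, \<open>y\<close>. In this form the steps of a continued fraction need no
  distinction between finite and infinite values.
\<close>

lemma Fin_divide_cancel:
  "c \<noteq> 0 \<Longrightarrow> Fin (c * x) / Fin (c * y) = Fin x / Fin y"
  by simp

lemma Fin_add_divide:
  "x \<noteq> 0 \<or> y \<noteq> 0 \<Longrightarrow> Fin c + Fin x / Fin y = Fin (c * y + x) / Fin y"
  by (auto simp: field_simps)

lemma Fin_mult_divide:
  "c \<noteq> 0 \<Longrightarrow> x \<noteq> 0 \<or> y \<noteq> 0 \<Longrightarrow> Fin c * (Fin x / Fin y) = Fin (c * x) / Fin y"
  by auto

lemma Fin_divide_divide: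
  "c \<noteq> 0 \<Longrightarrow> x \<noteq> 0 \<or> y \<noteq> 0 \<Longrightarrow> Fin c / (Fin x / Fin y) = Fin (c * y) / Fin x"
  by auto

text \<open>
  The right-hand side is \<open>pnum j / K\<^sub>j\<close> with \<open>K\<^sub>j = (1 + q\<^bsup>2j\<^esup>) D j / D (j+1)\<close>, in homogeneous coordinates.
  The recurrence is the induction step. Nonvanishing of the partial numerators keeps the
  coordinates from vanishing together when \<open>D j = 0\<close>.
\<close>

lemma cfrac_tail:
  assumes q: "norm q < 1" and a: "norm a < 1" "a \<noteq> 0"
    and pn: "\<And>j. j \<ge> 1 \<Longrightarrow> pnum q a b j \<noteq> 0"
    and j: "1 \<le> j" "j \<le> s + 1"
  shows "cfrac (map (\<lambda>j. (Fin (pnum q a b j), Fin ((1 - a * b) * (1 + q ^ (2 * j))))) [j..<s + 1]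
           @ [(Fin (pnum q a b (s + 1)),
               Fin (1 + q ^ (2 * s + 2)) * (Fin (D q a b (s + 1)) / Fin (D q a b (s + 2))))])
       = Fin (pnum q a b j * D q a b (j + 1)) / Fin ((1 + q ^ (2 * j)) * D q a b j)"
  using j(2) j(1)
proof (induction j rule: inc_induct)
  case base
  have nz: "1 + q ^ (2 * s + 2) \<noteq> 0" by (rule one_plus_power_nonzero[OF q]) simp
  note D0 = consecutive_D_not_both_zero[OF q a, of "s + 1" b]
  have plus0: "z + Fin 0 = z" for z by (cases z) auto
  show ?case
    using D0 nz pn[of "s + 1"]
    by (simp add: plus0 Fin_mult_divide Fin_divide_divide del: divide_ecomplex.simps times_ecomplex.simps)
next
  case (step j)
  let ?c = "1 + q ^ (2 * j)" and ?d = "1 + q ^ (2 * j + 2)"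
  have nz: "?c \<noteq> 0" "?d \<noteq> 0" using step.prems by (intro one_plus_power_nonzero[OF q]; simp)+
  note D0 = consecutive_D_not_both_zero[OF q a step.prems, of b]
    consecutive_D_not_both_zero[OF q a, of "j + 1" b]
  have "Fin ((1 - a * b) * ?c) + Fin (pnum q a b (j + 1) * D q a b (j + 2)) / Fin (?d * D q a b (j + 1))
      = Fin ((1 - a * b) * ?c * (?d * D q a b (j + 1)) + pnum q a b (j + 1) * D q a b (j + 2))
        / Fin (?d * D q a b (j + 1))"
    using nz D0 pn[of "j + 1"] by (intro Fin_add_divide) auto
  also have "\<dots> = Fin (?d * (?c * D q a b j)) / Fin (?d * D q a b (j + 1))"
    using D_recurrence[OF q a step.prems, of b] by (simp only: mult_ac)
  also have "\<dots> = Fin (?c * D q a b j) / Fin (D q a b (j + 1))"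
    by (rule Fin_divide_cancel[OF nz(2)])
  finally have *: "Fin ((1 - a * b) * ?c)
        + Fin (pnum q a b (j + 1) * D q a b (j + 2)) / Fin (?d * D q a b (j + 1))
      = Fin (?c * D q a b j) / Fin (D q a b (j + 1))" .
  have "Fin (pnum q a b j) / (Fin (?c * D q a b j) / Fin (D q a b (j + 1)))
      = Fin (pnum q a b j * D q a b (j + 1)) / Fin (?c * D q a b j)"
    using nz D0 pn[OF step.prems] by (intro Fin_divide_divide) auto
  with * step show ?case
    by (simp add: upt_conv_Cons del: upt_Suc divide_ecomplex.simps plus_ecomplex.simps)
qed

theorem theorem2p1:
  fixes q a b :: complex and s :: nat
  assumes "norm q < 1" and "norm a < 1" and "a \<noteq> 0"
    and "\<And>j::nat. j \<ge> 1 \<Longrightarrow> pnum q a b j \<noteq> 0"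
  shows "Fin (qpoch_inf (a\<^sup>2 * q ^ 3) (q ^ 4) * qpoch_inf (b\<^sup>2 * q ^ 3) (q ^ 4))
           / Fin (qpoch_inf (a\<^sup>2 * q) (q ^ 4) * qpoch_inf (b\<^sup>2 * q) (q ^ 4))
       = cfrac ([(Fin 1, Fin (1 - a * b))]
           @ map (\<lambda>j. (Fin (pnum q a b j), Fin ((1 - a * b) * (1 + q ^ (2 * j))))) [1..<s + 1]
           @ [(Fin (pnum q a b (s + 1)),
               Fin (1 + q ^ (2 * s + 2)) * (Fin (D q a b (s + 1)) / Fin (D q a b (s + 2))))])"
    (is "_ = cfrac ([?h] @ ?tail)")
proof -
  note q = assms(1) and a = assms(2,3)
  have nz: "1 + q\<^sup>2 \<noteq> 0" using one_plus_power_nonzero[OF q] by simp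
  define A1 where "A1 = qpoch_inf (a\<^sup>2 * q) (q ^ 4)"
  define A3 where "A3 = qpoch_inf (a\<^sup>2 * q ^ 3) (q ^ 4)"
  define B1 where "B1 = qpoch_inf (b\<^sup>2 * q) (q ^ 4)"
  define B3 where "B3 = qpoch_inf (b\<^sup>2 * q ^ 3) (q ^ 4)"
  have q4: "norm (q ^ 4) < 1" using norm_power_less_one[OF q] by simp
  have w: "norm (a\<^sup>2 * q) < 1" "norm (a\<^sup>2 * q ^ 3) < 1"
    using norm_square_mult_power_less_one[OF q a(1), of 1]
      norm_square_mult_power_less_one[OF q a(1), of 3] by simp_all
  have A: "A1 \<noteq> 0" "A3 \<noteq> 0"
    unfolding A1_def A3_def using qpoch_inf_nonzero[OF _ q4] w by blast+
  have B: "B3 \<noteq> 0 \<or> B1 \<noteq> 0"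
    unfolding B1_def B3_def using qpoch_inf_odd_classes_not_both_zero[OF q, of "b\<^sup>2"] by auto
  have D1: "D q a b 1 = B3 / A1" unfolding A1_def B3_def by (rule D_1_eq_product[OF q a])
  have E: "(1 - a * b) * ((1 + q\<^sup>2) * D q a b 1) + pnum q a b 1 * D q a b 2 = (1 + q\<^sup>2) * (B1 / A3)"
    unfolding A3_def B1_def using D_first_step[OF q a, of b] by (simp only: mult.assoc)
  have D12: "D q a b 1 \<noteq> 0 \<or> D q a b 2 \<noteq> 0"
    using consecutive_D_not_both_zero[OF q a, of 1 b] by (simp add: numeral_2_eq_2)
  have "cfrac ?tail = Fin (pnum q a b 1 * D q a b 2) / Fin ((1 + q\<^sup>2) * D q a b 1)"
    using cfrac_tail[OF q a assms(4), of 1 s] by (simp only: one_add_one mult_1_right)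
  then have "cfrac ([?h] @ ?tail) =
      Fin 1 / (Fin (1 - a * b) + Fin (pnum q a b 1 * D q a b 2) / Fin ((1 + q\<^sup>2) * D q a b 1))"
    by (simp only: append.simps cfrac.simps)
  also have "\<dots> = Fin 1 / (Fin ((1 + q\<^sup>2) * (B1 / A3)) / Fin ((1 + q\<^sup>2) * D q a b 1))"
    using D12 nz assms(4)[of 1] by (subst Fin_add_divide) (simp_all only: E mult_eq_0_iff, auto)
  also have "\<dots> = Fin 1 / (Fin (B1 / A3) / Fin (B3 / A1))"
    unfolding D1 by (simp only: Fin_divide_cancel[OF nz])
  also have "\<dots> = Fin (B3 / A1) / Fin (B1 / A3)"
    using A B by (subst Fin_divide_divide) auto
  also have "\<dots> = Fin (A3 * B3) / Fin (A1 * B1)"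
    using A B by auto
  finally show ?thesis unfolding A1_def A3_def B1_def B3_def ..
qed

end
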